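(* For $0<a<1$ let $\widetilde{\beta}_a:=\beta_{a,1-a}$ and let $\widetilde{\beta}'_a(dx):=\beta'_{1-a,a}(dx-1)$ be the translate of $\beta'_{1-a,a}$ by $+1$ (the law of $X+1$ when $X$ has law $\beta'_{1-a,a}$). Then for all $0<a,b<1$, $$\widetilde{\beta}_a \circlearrowright \widetilde{\beta}_b = \widetilde{\beta}_{ab},\qquad \widetilde{\beta}'_a \circlearrowright \widetilde{\beta}'_b = \widetilde{\beta}'_{ab},$$ where $\circlearrowright$ denotes multiplicative monotone convolution of probability measures on $[0,\infty)$.
   Context: $\beta_{p,q}(dx) = \frac{1}{B(p,q)} x^{p-1}(1-x)^{q-1}1_{[0,1]}(x)\,dx$ and $\beta'_{p,q}(dx)=\frac{1}{B(p,q)} \frac{x^{p-1}}{(1+x)^{p+q}}1_{[0,\infty)}(x)\,dx$ for $p,q>0$, with $B$ the beta function. For a probability measure $\mu$ on $[0,\infty)$ let $G_\mu(z)=\int\frac{1}{z-x}\mu(dx)$, $F_\mu=1/G_\mu$ (on $\mathbb{C}\setminus[0,\infty)$), and let $\eta_\mu(z):=1-zF_\mu(\frac1z)$ be the $\eta$-transform. The multiplicative monotone convolution $\mu\circlearrowright\nu$ of probability measures $\mu,\nu$ on $[0,\infty)$ is the probability measure on $[0,\infty)$ characterized by $\eta_{\mu\circlearrowright\nu}(z)=\eta_\mu(\eta_\nu(z))$ for $z\in(-\infty,0)$. *)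

theory Defs
  imports "HOL-Probability.Probability"
begin

definition beta_measure :: "real \<Rightarrow> real \<Rightarrow> real measure" where
  "beta_measure p q = density lborel
     (\<lambda>x. ennreal (x powr (p - 1) * (1 - x) powr (q - 1) / Beta p q * indicator {0..1} x))"

definition beta_prime_measure :: "real \<Rightarrow> real \<Rightarrow> real measure" where
  "beta_prime_measure p q = density lborel
     (\<lambda>x. ennreal (x powr (p - 1) / (1 + x) powr (p + q) / Beta p q * indicator {0..} x))"

definition cauchy_transform :: "real measure \<Rightarrow> complex \<Rightarrow> complex" where
  "cauchy_transform \<mu> z = (LINT x|\<mu>. 1 / (z - complex_of_real x))"

definition F_transform :: "real measure \<Rightarrow> complex \<Rightarrow> complex" where
  "F_transform \<mu> z = 1 / cauchy_transform \<mu> z"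

(* For measures on [0,\<infinity>) the formula is meaningful on the complement of [0,\<infinity>).
   The value at 0 is the limit along (-\<infinity>,0); it is only met when composing with
   the eta transform of the point mass at 0, which vanishes identically. *)
definition eta_transform :: "real measure \<Rightarrow> complex \<Rightarrow> complex" where
  "eta_transform \<mu> z = (if z = 0 then 0 else 1 - z * F_transform \<mu> (1 / z))"

definition nonneg_distribution :: "real measure \<Rightarrow> bool" where
  "nonneg_distribution \<mu> \<longleftrightarrow> real_distribution \<mu> \<and> (AE x in \<mu>. 0 \<le> x)"

(* Meaningful for arguments satisfying nonneg_distribution. *)
definition mult_monotone_conv :: "real measure \<Rightarrow> real measure \<Rightarrow> real measure" where
  "mult_monotone_conv \<mu> \<nu> = (THE \<rho>. nonneg_distribution \<rho> \<and>
     (\<forall>z::real. z < 0 \<longrightarrow> eta_transform \<rho> (complex_of_real z) =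
        eta_transform \<mu> (eta_transform \<nu> (complex_of_real z))))"

definition beta_tilde :: "real \<Rightarrow> real measure" where
  "beta_tilde a = beta_measure a (1 - a)"

definition beta_prime_tilde :: "real \<Rightarrow> real measure" where
  "beta_prime_tilde a = distr (beta_prime_measure (1 - a) a) borel (\<lambda>x. x + 1)"

end

theory Submission
  imports Defs
begin

text \<open>On the negative axis the eta transforms are \<open>1 - (1 - w) powr a\<close> and
  \<open>1 / (1 - (1 - 1 / w) powr a)\<close>. Both families are conjugate to power maps
  (by \<open>w \<mapsto> 1 - w\<close> and \<open>w \<mapsto> 1 - 1 / w\<close>), so composition multiplies the exponents. The Cauchy transforms
  come from the substitution \<open>y = (1 + c) * x / (1 + c * x)\<close> of the unit interval, and \<open>x = 1 / y - 1\<close> reduces the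
  second family to the first. A measure on the half line is determined by its eta transform because
  the Cauchy transform near \<open>-1\<close> encodes the moments of the bounded variable \<open>1 / (1 + X)\<close>.\<close>

section \<open>Power series coefficients and moments of bounded laws\<close>

text \<open>Letting \<open>x\<close> tend to 0 kills the constant term; dividing by \<open>x\<close>
  then shifts the coefficients, and induction applies. The point \<open>x = 0\<close> is left out of
  the hypothesis so that it survives this division.\<close>

lemma powser_coeff_eq_0:
  fixes a :: "nat \<Rightarrow> real"
  assumes "0 < r" and "\<And>x. x \<noteq> 0 \<Longrightarrow> \<bar>x\<bar> < r \<Longrightarrow> (\<lambda>n. a n * x ^ n) sums 0"
  shows "a n = 0"
  using assms(2)
proof (induction n arbitrary: a)
  case 0
  have "((\<lambda>x::real. 0::real) \<longlongrightarrow> a 0) (at 0)"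
    by (rule powser_limit_0_strong[OF assms(1)]) (use 0 in auto)
  then show ?case
    by (simp add: tendsto_const_iff)
next
  case (Suc n)
  have "((\<lambda>x::real. 0::real) \<longlongrightarrow> a 0) (at 0)"
    by (rule powser_limit_0_strong[OF assms(1)]) (use Suc.prems in auto)
  then have a0: "a 0 = 0"
    by (simp add: tendsto_const_iff)
  show ?case
  proof (rule Suc.IH[of "\<lambda>n. a (Suc n)"])
    fix x :: real assume x: "x \<noteq> 0" "\<bar>x\<bar> < r"
    have "(\<lambda>n. a (Suc n) * x ^ Suc n) sums 0"
      using Suc.prems[OF x] a0 by (subst sums_Suc_iff) simp
    then have "(\<lambda>n. a (Suc n) * x ^ Suc n / x) sums (0 / x)"
      by (rule sums_divide)
    then show "(\<lambda>n. a (Suc n) * x ^ n) sums 0"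
      using x by simp
  qed
qed

text \<open>The exponential series is integrated term by term. The bound \<open>C\<close> dominates
  the integrals of the absolute values by the terms of
  \<open>exp (\<bar>t\<bar> * C)\<close>.\<close>

lemma char_sums_moments:
  assumes "real_distribution M" and bd: "AE x in M. \<bar>x\<bar> \<le> C"
  shows "(\<lambda>n. (\<i> * of_real t) ^ n / fact n * of_real (LINT x|M. x ^ n)) sums char M t"
proof -
  interpret real_distribution M by fact
  define f where "f n x = (\<i> * of_real t) ^ n / fact n * complex_of_real (x ^ n)" for n x
  have bd': "AE x in M. norm (f n x) \<le> (\<bar>t\<bar> * C) ^ n / fact n" for n
    using bd
  proof eventually_elim
    case (elim x)
    have "\<bar>x\<bar> ^ n \<le> C ^ n" using elim by (intro power_mono) auto
    then show ?case
      by (simp add: f_def norm_mult norm_divide norm_power power_mult_distrib divide_right_mono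
          mult_left_mono power_abs)
  qed
  have int: "integrable M (f n)" for n
    by (rule integrable_const_bound[OF bd']) (simp add: f_def)
  have "(\<lambda>n. integral\<^sup>L M (f n)) sums (LINT x|M. (\<Sum>n. f n x))"
  proof (rule sums_integral[OF int])
    have "summable (\<lambda>n. norm (f n x))" for x
    proof -
      have "(\<lambda>n. norm (f n x)) = (\<lambda>n. inverse (fact n) * \<bar>t * x\<bar> ^ n)"
        by (auto simp: f_def norm_mult norm_divide norm_power power_mult_distrib abs_mult
            power_abs divide_simps)
      then show ?thesis using summable_exp[of "\<bar>t * x\<bar>"] by simp
    qed
    then show "AE x in M. summable (\<lambda>n. norm (f n x))" by simp
    have "summable (\<lambda>n. (\<bar>t\<bar> * C) ^ n / fact n)"
      using summable_exp[of "\<bar>t\<bar> * C"] by (simp add: divide_inverse mult.commute)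
    then show "summable (\<lambda>n. LINT x|M. norm (f n x))"
    proof (rule summable_comparison_test')
      fix n
      have "(LINT x|M. norm (f n x)) \<le> (LINT x|M. (\<bar>t\<bar> * C) ^ n / fact n)"
        by (rule integral_mono_AE[OF _ _ bd']) (use int in auto)
      then show "norm (LINT x|M. norm (f n x)) \<le> (\<bar>t\<bar> * C) ^ n / fact n"
        using prob_space by simp
    qed
  qed
  moreover have "(\<Sum>n. f n x) = iexp (t * x)" for x
  proof -
    have "(\<lambda>n. (\<i> * of_real (t * x)) ^ n /\<^sub>R fact n) sums exp (\<i> * of_real (t * x))"
      by (rule exp_converges)
    moreover have "(\<i> * of_real (t * x)) ^ n /\<^sub>R fact n = f n x" for n
      by (simp add: f_def scaleR_conv_of_real power_mult_distrib divide_simps)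
    ultimately show ?thesis by (simp add: sums_iff)
  qed
  moreover have "integral\<^sup>L M (f n) = (\<i> * of_real t) ^ n / fact n * of_real (LINT x|M. x ^ n)" for n
    unfolding f_def by (simp only: integral_mult_right_zero integral_complex_of_real)
  ultimately show ?thesis
    by (simp add: char_def)
qed

text \<open>For bounded variables the moments fix every characteristic function value through its
  series, and Levy uniqueness finishes.\<close>

lemma real_distribution_eqI_moments:
  assumes "real_distribution M" "real_distribution N"
    and "AE x in M. \<bar>x\<bar> \<le> C" "AE x in N. \<bar>x\<bar> \<le> C"
    and "\<And>n. (LINT x|M. x ^ n) = (LINT x|N. x ^ n)"
  shows "M = N"
proof (rule Levy_uniqueness[OF assms(1,2)])
  show "char M = char N"
  proof
    fix t show "char M t = char N t"
      using char_sums_moments[OF assms(1,3), of t] char_sums_moments[OF assms(2,4), of t] assms(5)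
      by (simp add: sums_iff)
  qed
qed

section \<open>Uniqueness from the Cauchy and eta transforms\<close>

text \<open>With \<open>y = 1 / (1 + x)\<close>, the kernel is \<open>y / (1 - s * y)\<close>, so near \<open>s = 0\<close> the Cauchy transform
  generates the moments of the law of \<open>1 / (1 + X)\<close>.\<close>

lemma cauchy_sums_moments:
  assumes "nonneg_distribution M" and s: "\<bar>s\<bar> < 1"
  shows "(\<lambda>n. (LINT x|M. (1 / (1 + x)) ^ Suc n) * s ^ n) sums (LINT x|M. 1 / (1 - s + x))"
proof -
  interpret real_distribution M using assms by (simp add: nonneg_distribution_def)
  have nonneg: "AE x in M. 0 \<le> x" using assms by (simp add: nonneg_distribution_def)
  define f where "f n x = (1 / (1 + x)) ^ Suc n * s ^ n" for n and x :: real
  have bound: "norm (f n x) \<le> \<bar>s\<bar> ^ n" if "0 \<le> x" for n x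
  proof -
    have "(1 / (1 + x)) ^ Suc n \<le> 1" "0 \<le> (1 / (1 + x)) ^ Suc n"
      using that by (auto intro!: power_le_one simp del: power_Suc)
    moreover have "norm (f n x) = (1 / (1 + x)) ^ Suc n * \<bar>s\<bar> ^ n"
      using that by (simp add: f_def abs_mult power_abs del: power_Suc)
    ultimately show ?thesis
      by (metis abs_ge_zero mult_left_le_one_le zero_le_power)
  qed
  have bd: "AE x in M. norm (f n x) \<le> \<bar>s\<bar> ^ n" for n
    using nonneg by eventually_elim (rule bound)
  have int: "integrable M (f n)" for n
    by (rule integrable_const_bound[OF bd]) (simp add: f_def)
  have summ: "summable (\<lambda>n. \<bar>s\<bar> ^ n)" using s by (simp add: summable_geometric)
  have "(\<lambda>n. integral\<^sup>L M (f n)) sums (LINT x|M. (\<Sum>n. f n x))"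
  proof (rule sums_integral[OF int])
    show "AE x in M. summable (\<lambda>n. norm (f n x))"
      using nonneg
    proof eventually_elim
      case (elim x)
      show ?case by (rule summable_comparison_test'[OF summ]) (use bound[OF elim] in simp)
    qed
    show "summable (\<lambda>n. LINT x|M. norm (f n x))"
    proof (rule summable_comparison_test'[OF summ])
      fix n
      have "(LINT x|M. norm (f n x)) \<le> (LINT x|M. \<bar>s\<bar> ^ n)"
        by (rule integral_mono_AE[OF _ _ bd]) (use int in auto)
      then show "norm (LINT x|M. norm (f n x)) \<le> \<bar>s\<bar> ^ n"
        using prob_space by simp
    qed
  qed
  moreover have "(LINT x|M. (\<Sum>n. f n x)) = (LINT x|M. 1 / (1 - s + x))"
  proof (rule integral_cong_AE)
    show "AE x in M. (\<Sum>n. f n x) = 1 / (1 - s + x)"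
      using nonneg
    proof eventually_elim
      case (elim x)
      \<comment> \<open>Since \<open>x\<close> is nonnegative, the ratio of the geometric series is
        at most \<open>\<bar>s\<bar>\<close> in absolute value.\<close>
      have "\<bar>s / (1 + x)\<bar> < 1" using s elim by (simp add: divide_less_eq)
      then have "(\<lambda>n. 1 / (1 + x) * (s / (1 + x)) ^ n) sums (1 / (1 + x) * (1 / (1 - s / (1 + x))))"
        by (intro sums_mult geometric_sums) auto
      moreover have "1 / (1 + x) * (1 / (1 - s / (1 + x))) = 1 / (1 - s + x)"
        using elim s by (simp add: field_simps)
      moreover have "1 / (1 + x) * (s / (1 + x)) ^ n = f n x" for n
        by (simp add: f_def power_divide)
      ultimately show ?case by (simp add: sums_iff)
    qed
  qed (use int in \<open>auto simp: f_def\<close>)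
  moreover have "integral\<^sup>L M (f n) = (LINT x|M. (1 / (1 + x)) ^ Suc n) * s ^ n" for n
    unfolding f_def by (rule integral_mult_left_zero)
  ultimately show ?thesis
    by simp
qed

text \<open>The variable itself may lack moments, so the comparison is made for the bounded variable
  \<open>h X\<close>, whose moments are coefficients of the Cauchy transform around -1. The law is
  then recovered by inverting \<open>h\<close>.\<close>

lemma nonneg_distribution_eqI_cauchy:
  assumes M: "nonneg_distribution M" and N: "nonneg_distribution N"
    and eq: "\<And>t. 0 < t \<Longrightarrow> (LINT x|M. 1 / (t + x)) = (LINT x|N. 1 / (t + x))"
  shows "M = N"
proof -
  have rM: "real_distribution M" and rN: "real_distribution N"
    using M N by (simp_all add: nonneg_distribution_def)
  interpret M: real_distribution M by fact
  interpret N: real_distribution N by fact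
  define h :: "real \<Rightarrow> real" where "h x = 1 / (1 + x)" for x
  have [measurable]: "h \<in> borel_measurable borel" unfolding h_def by measurable
  have mom: "(LINT x|M. h x ^ n) = (LINT x|N. h x ^ n)" for n
  \<comment> \<open>The expansion starts with the first moment; the zeroth one is the total
    mass.\<close>
  proof (cases n)
    case 0
    then show ?thesis using M.prob_space N.prob_space by simp
  next
    case (Suc k)
    have "(LINT x|M. h x ^ Suc k) - (LINT x|N. h x ^ Suc k) = 0"
    \<comment> \<open>Equality of the transforms is used at \<open>t = 1 - s\<close>, which is
      positive for \<open>\<bar>s\<bar> < 1\<close>.\<close>
    proof (rule powser_coeff_eq_0[of 1 "\<lambda>k. (LINT x|M. h x ^ Suc k) - (LINT x|N. h x ^ Suc k)"])
      fix s :: real assume s: "\<bar>s\<bar> < 1"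
      show "(\<lambda>n. ((LINT x|M. h x ^ Suc n) - (LINT x|N. h x ^ Suc n)) * s ^ n) sums 0"
        using sums_diff[OF cauchy_sums_moments[OF M s] cauchy_sums_moments[OF N s]] eq[of "1 - s"] s
        by (simp add: h_def left_diff_distrib del: power_Suc)
    qed simp
    with Suc show ?thesis by simp
  qed
  have bdd: "AE y in distr L borel h. \<bar>y\<bar> \<le> 1" if L: "nonneg_distribution L" for L
  proof -
    interpret real_distribution L using L by (simp add: nonneg_distribution_def)
    have "AE x in L. \<bar>h x\<bar> \<le> 1"
      using L unfolding nonneg_distribution_def by (auto simp: h_def elim!: eventually_mono)
    then show ?thesis by (subst AE_distr_iff) auto
  qed
  have "distr M borel h = distr N borel h"
  proof (rule real_distribution_eqI_moments[of _ _ 1])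
    fix n show "(LINT y|distr M borel h. y ^ n) = (LINT y|distr N borel h. y ^ n)"
      by (simp add: integral_distr mom)
  qed (use M N bdd in auto)
  then have "distr (distr M borel h) borel (\<lambda>y. 1 / y - 1) = distr (distr N borel h) borel (\<lambda>y. 1 / y - 1)"
    by simp
  \<comment> \<open>This holds at every real number, including \<open>x = -1\<close>: there division
    by zero gives \<open>h x = 0\<close>, which is sent back to -1.\<close>
  moreover have "(\<lambda>y. 1 / y - 1) \<circ> h = (\<lambda>x. x)" by (auto simp: h_def)
  ultimately show ?thesis by (simp add: distr_distr distr_id2)
qed

lemma cauchy_transform_of_real:
  "cauchy_transform M (complex_of_real r) = complex_of_real (LINT x|M. 1 / (r - x))"
proof -
  have "cauchy_transform M (complex_of_real r) = (LINT x|M. complex_of_real (1 / (r - x)))"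
    unfolding cauchy_transform_def by simp
  then show ?thesis by (simp only: integral_complex_of_real)
qed

lemma nonneg_distribution_eqI_eta:
  assumes M: "nonneg_distribution M" and N: "nonneg_distribution N"
    and eq: "\<And>z::real. z < 0 \<Longrightarrow>
      eta_transform M (complex_of_real z) = eta_transform N (complex_of_real z)"
  shows "M = N"
proof (rule nonneg_distribution_eqI_cauchy[OF M N])
  fix t :: real assume t: "0 < t"
  \<comment> \<open>At \<open>z = - 1 / t\<close> the factor \<open>z\<close> is nonzero and
    cancels. Reciprocals are injective even at 0, as \<open>1 / 0 = 0\<close>, so no nonvanishing of
    the Cauchy transform has to be shown.\<close>
  have "cauchy_transform M (complex_of_real (- t)) = cauchy_transform N (complex_of_real (- t))"
    using eq[of "- 1 / t"] t by (simp add: eta_transform_def F_transform_def)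
  then have "(LINT x|M. 1 / (- t - x)) = (LINT x|N. 1 / (- t - x))"
    by (simp only: cauchy_transform_of_real of_real_eq_iff)
  moreover have "(\<lambda>x. 1 / (- t - x)) = (\<lambda>x. - (1 / (t + x)))"
    by (rule ext) (metis minus_divide_right minus_add_distrib uminus_add_conv_diff diff_conv_add_uminus)
  ultimately show "(LINT x|M. 1 / (t + x)) = (LINT x|N. 1 / (t + x))"
    by simp
qed

text \<open>Resolves the definite description: the candidate supplies existence, and uniqueness
  holds because two solutions share their eta transform on the negative axis.\<close>

lemma mult_monotone_conv_eqI:
  assumes "nonneg_distribution \<rho>"
    and "\<And>z::real. z < 0 \<Longrightarrow> eta_transform \<rho> (complex_of_real z) =
      eta_transform \<mu> (eta_transform \<nu> (complex_of_real z))"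
  shows "mult_monotone_conv \<mu> \<nu> = \<rho>"
  unfolding mult_monotone_conv_def
  by (rule the_equality) (use assms in \<open>auto intro!: nonneg_distribution_eqI_eta\<close>)

section \<open>Change of variables and beta integrals\<close>

text \<open>A bridge from Bochner integrals over \<open>lborel\<close> to absolute integrability on
  a set, the form in which the change of variables theorem is stated. Borel measurability allows
  passing between \<open>lborel\<close> and its completion.\<close>

lemma has_bochner_integral_indicator_iff:
  fixes f :: "real \<Rightarrow> real"
  assumes [measurable]: "f \<in> borel_measurable borel" "S \<in> sets borel"
  shows "has_bochner_integral lborel (\<lambda>x. indicator S x * f x) b \<longleftrightarrow>
    f absolutely_integrable_on S \<and> integral S f = b"
proof -
  have int: "f absolutely_integrable_on S \<longleftrightarrow> integrable lborel (\<lambda>x. indicator S x * f x)"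
    unfolding set_integrable_def by (subst integrable_completion) auto
  have "integral S f = (LINT x|lborel. indicator S x * f x)" if "f absolutely_integrable_on S"
  proof -
    have "integral S f = (LINT x:S|lebesgue. f x)"
      using set_lebesgue_integral_eq_integral[OF that] by simp
    also have "\<dots> = (LINT x|lborel. indicator S x * f x)"
      unfolding set_lebesgue_integral_def by (subst integral_completion) auto
    finally show ?thesis .
  qed
  with int show ?thesis by (auto simp: has_bochner_integral_iff)
qed

lemma has_bochner_integral_change_of_variables:
  fixes f g g' :: "real \<Rightarrow> real"
  assumes "f \<in> borel_measurable borel" "(\<lambda>x. \<bar>g' x\<bar> * f (g x)) \<in> borel_measurable borel"
    and S: "S \<in> sets borel" "g ` S \<in> sets borel"
    and "\<And>x. x \<in> S \<Longrightarrow> (g has_field_derivative g' x) (at x)" and "inj_on g S"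
  shows "has_bochner_integral lborel (\<lambda>x. indicator (g ` S) x * f x) b \<longleftrightarrow>
    has_bochner_integral lborel (\<lambda>x. indicator S x * (\<bar>g' x\<bar> * f (g x))) b"
  unfolding has_bochner_integral_indicator_iff[OF assms(1) S(2)]
    has_bochner_integral_indicator_iff[OF assms(2) S(1)]
  by (rule has_absolute_integral_change_of_variables_1'[symmetric])
    (use assms in \<open>auto intro: has_field_derivative_at_within\<close>)

text \<open>The map \<open>g\<close> is the Moebius transformation of the unit interval fixing both
  endpoints, with \<open>1 - g x = (1 - x) / (1 + c * x)\<close> and derivative
  \<open>(1 + c) / (1 + c * x)\<^sup>2\<close>. Substituting it into the Beta integral leaves
  exactly one factor \<open>1 + c * x\<close> in the denominator, because the exponents
  \<open>a - 1\<close> and \<open>- a\<close> sum to -1.\<close>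

lemma has_bochner_integral_beta_kernel:
  fixes a c :: real
  assumes "0 < a" "a < 1" "-1 < c"
  shows "has_bochner_integral lborel
    (\<lambda>x. indicator {0<..<1} x * (x powr (a - 1) * (1 - x) powr - a / (1 + c * x)))
    (Beta a (1 - a) / (1 + c) powr a)"
proof -
  let ?I = "{0<..<1::real}"
  define f where "f y = y powr (a - 1) * (1 - y) powr - a" for y :: real
  define g where "g x = (1 + c) * x / (1 + c * x)" for x
  define g' where "g' x = (1 + c) / (1 + c * x)\<^sup>2" for x
  have [measurable]: "f \<in> borel_measurable borel" "g \<in> borel_measurable borel" "g' \<in> borel_measurable borel"
    by (auto simp: f_def[abs_def] g_def[abs_def] g'_def[abs_def])
  have pos: "0 < 1 + c * x" if "x \<in> ?I" for x
  proof -
    \<comment> \<open>A convex combination of 1 and \<open>1 + c\<close>, hence positive also for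
      negative \<open>c > -1\<close>.\<close>
    have "1 + c * x = (1 - x) + (1 + c) * x" by (simp add: algebra_simps)
    moreover have "0 < (1 + c) * x" using that assms by simp
    ultimately show ?thesis using that by auto
  qed
  have one_minus: "1 - g x = (1 - x) / (1 + c * x)" if "x \<in> ?I" for x
    using pos[OF that] by (simp add: g_def field_simps)
  have gI: "g x \<in> ?I" if "x \<in> ?I" for x
  proof -
    have "0 < 1 - g x" using one_minus[OF that] pos[OF that] that by simp
    moreover have "0 < g x" using pos[OF that] that assms by (simp add: g_def)
    ultimately show ?thesis by simp
  qed
  have inv: "g x / (1 + c - c * g x) = x" if "x \<in> ?I" for x
  proof -
    have "1 + c - c * g x = (1 + c) / (1 + c * x)"
      using pos[OF that] by (simp add: g_def field_simps)
    then show ?thesis using pos[OF that] assms by (simp add: g_def)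
  qed
  have "inj_on g ?I"
    by (rule inj_on_inverseI[of _ "\<lambda>y. y / (1 + c - c * y)"]) (rule inv)
  have img: "g ` ?I = ?I"
  proof
    show "?I \<subseteq> g ` ?I"
    proof
      fix y assume y: "y \<in> ?I"
      \<comment> \<open>The preimage of \<open>y\<close> is \<open>y / D\<close>, obtained by
        solving \<open>g x = y\<close> for \<open>x\<close>.\<close>
      define D where "D = 1 + c - c * y"
      have "D = (1 + c) * (1 - y) + y" by (simp add: D_def algebra_simps)
      moreover have "0 < (1 + c) * (1 - y)" using y assms by simp
      ultimately have D: "y < D" "0 < D" using y by auto
      have "1 + c * (y / D) = (1 + c) / D" using D by (simp add: field_simps D_def)
      then have "g (y / D) = y" using D assms by (simp add: g_def)
      moreover have "y / D \<in> ?I" using y D by simp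
      ultimately show "y \<in> g ` ?I" by (metis image_eqI)
    qed
  qed (use gI in auto)
  have "(f has_integral Beta a (1 - a)) ?I"
    using has_integral_Beta_real[of a "1 - a"] assms
    by (simp add: has_integral_Icc_iff_Ioo f_def[abs_def])
  \<comment> \<open>Nonnegativity of \<open>f\<close> upgrades the gauge integral to absolute
    integrability.\<close>
  then have "f absolutely_integrable_on ?I \<and> integral ?I f = Beta a (1 - a)"
    using assms by (auto intro!: nonnegative_absolutely_integrable_1 integral_unique simp: f_def
        dest: has_integral_integrable)
  then have "has_bochner_integral lborel (\<lambda>x. indicator (g ` ?I) x * f x) (Beta a (1 - a))"
    by (simp add: has_bochner_integral_indicator_iff img)
  then have "has_bochner_integral lborel (\<lambda>x. indicator ?I x * (\<bar>g' x\<bar> * f (g x))) (Beta a (1 - a))"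
  proof (subst (asm) has_bochner_integral_change_of_variables[where g' = g'])
    fix x assume x: "x \<in> ?I"
    show "(g has_field_derivative g' x) (at x)"
      unfolding g_def g'_def using pos[OF x]
      by (auto intro!: derivative_eq_intros simp: power2_eq_square field_simps)
  qed (use \<open>inj_on g ?I\<close> img in auto)
  then have "has_bochner_integral lborel (\<lambda>x. indicator ?I x * (\<bar>g' x\<bar> * f (g x)) / (1 + c) powr a)
      (Beta a (1 - a) / (1 + c) powr a)"
    by (rule has_bochner_integral_divide_zero)
  moreover have "indicator ?I x * (\<bar>g' x\<bar> * f (g x)) / (1 + c) powr a =
      indicator ?I x * (x powr (a - 1) * (1 - x) powr - a / (1 + c * x))" for x
  proof (cases "x \<in> ?I")
    case True
    define P where "P = 1 + c * x"
    have P: "0 < P" using pos[OF True] by (simp add: P_def)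
    have "f (g x) = ((1 + c) * x / P) powr (a - 1) * ((1 - x) / P) powr - a"
      using one_minus[OF True] by (simp add: f_def g_def P_def)
    also have "\<dots> = (1 + c) powr (a - 1) * x powr (a - 1) * (1 - x) powr - a / (P powr (a - 1) * P powr - a)"
      using True P assms by (simp add: powr_mult powr_divide)
    \<comment> \<open>This cancels one of the two factors \<open>P\<close> in the denominator of
      \<open>g'\<close>.\<close>
    also have "P powr (a - 1) * P powr - a = 1 / P"
      using P by (simp add: powr_minus_divide powr_diff)
    also have "(1 + c) powr (a - 1) = (1 + c) powr a / (1 + c)"
      using assms by (simp add: powr_diff)
    finally have "f (g x) = (1 + c) powr a / (1 + c) * (x powr (a - 1) * (1 - x) powr - a) * P"
      by simp
    then show ?thesis
      using True P assms unfolding g'_def P_def[symmetric] by (simp add: power2_eq_square)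
  qed simp
  ultimately show ?thesis by simp
qed

text \<open>Substitution \<open>x = 1 / y - 1\<close>, a decreasing bijection from the unit interval
  to the half line; the weight \<open>1 / y\<^sup>2\<close> is the absolute value of its
  derivative.\<close>

lemma has_bochner_integral_inverse_shift:
  fixes f :: "real \<Rightarrow> real"
  assumes [measurable]: "f \<in> borel_measurable borel"
  shows "has_bochner_integral lborel (\<lambda>x. indicator {0<..} x * f x) b \<longleftrightarrow>
    has_bochner_integral lborel (\<lambda>y. indicator {0<..<1} y * (1 / y\<^sup>2 * f (1 / y - 1))) b"
proof -
  let ?g = "\<lambda>y::real. 1 / y - 1"
  have img: "?g ` {0<..<1} = {0<..}"
  proof
    show "{0<..} \<subseteq> ?g ` {0<..<1}"
    proof
      fix x :: real assume "x \<in> {0<..}"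
      then show "x \<in> ?g ` {0<..<1}" by (intro image_eqI[of _ _ "1 / (1 + x)"]) auto
    qed
  qed (auto simp: field_simps)
  have "has_bochner_integral lborel (\<lambda>x. indicator (?g ` {0<..<1}) x * f x) b \<longleftrightarrow>
    has_bochner_integral lborel (\<lambda>y. indicator {0<..<1} y * (\<bar>- (1 / y\<^sup>2)\<bar> * f (?g y))) b"
    by (rule has_bochner_integral_change_of_variables)
      (auto simp: img inj_on_def power2_eq_square intro!: derivative_eq_intros)
  then show ?thesis by (simp add: img)
qed

text \<open>With \<open>x = 1 / y - 1\<close> one has \<open>1 + x = 1 / y\<close> and
  \<open>x = (1 - y) / y\<close>, so collecting powers of \<open>y\<close> turns the beta prime
  weight into the beta weight.\<close>

lemma beta_prime_inverse_shift:
  fixes y :: real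
  assumes "0 < y" "y < 1"
  shows "1 / y\<^sup>2 * ((1 / y - 1) powr - a / (1 + (1 / y - 1))) = y powr (a - 1) * (1 - y) powr - a"
proof -
  have "(1 / y - 1) powr - a = ((1 - y) / y) powr - a"
    using assms by (simp add: field_simps)
  also have "\<dots> = (1 - y) powr - a * y powr a"
    using assms by (simp add: powr_divide powr_minus_divide)
  also have "y powr a = y powr (a - 1) * y"
    using assms by (simp add: powr_diff)
  finally show ?thesis using assms by (simp add: power2_eq_square)
qed

lemma has_bochner_integral_beta_prime:
  fixes a :: real
  assumes "0 < a" "a < 1"
  shows "has_bochner_integral lborel (\<lambda>x. indicator {0<..} x * (x powr - a / (1 + x))) (Beta a (1 - a))"
proof (subst has_bochner_integral_inverse_shift)
  \<comment> \<open>The case \<open>c = 0\<close> of the kernel integral is the plain Beta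
    integral.\<close>
  have "has_bochner_integral lborel
    (\<lambda>y. indicator {0<..<1} y * (y powr (a - 1) * (1 - y) powr - a)) (Beta a (1 - a))"
    using has_bochner_integral_beta_kernel[of a 0] assms by simp
  then show "has_bochner_integral lborel
      (\<lambda>y. indicator {0<..<1} y * (1 / y\<^sup>2 * ((1 / y - 1) powr - a / (1 + (1 / y - 1))))) (Beta a (1 - a))"
    by (rule has_bochner_integral_cong[THEN iffD1, OF refl _ refl, rotated])
      (metis beta_prime_inverse_shift greaterThanLessThan_iff indicator_simps(2) mult_zero_left)
qed simp

text \<open>The summand \<open>1 + x\<close> in the kernel comes from the translation by 1. Under
  \<open>x = 1 / y - 1\<close> the kernel \<open>1 / (t + (1 + x))\<close> becomes
  \<open>y / (1 + t * y) = (1 - 1 / (1 + t * y)) / t\<close>, so the integral is a difference of the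
  beta kernel integrals for \<open>c = 0\<close> and \<open>c = t\<close>.\<close>

lemma has_bochner_integral_beta_prime_kernel:
  fixes a t :: real
  assumes "0 < a" "a < 1" "0 < t"
  shows "has_bochner_integral lborel (\<lambda>x. indicator {0<..} x * (x powr - a / (1 + x) / (t + (1 + x))))
    (Beta a (1 - a) * (1 - (1 + t) powr - a) / t)"
proof (subst has_bochner_integral_inverse_shift)
  let ?k = "\<lambda>y::real. y powr (a - 1) * (1 - y) powr - a"
  have "has_bochner_integral lborel
    (\<lambda>y. (indicator {0<..<1} y * (?k y / (1 + 0 * y)) - indicator {0<..<1} y * (?k y / (1 + t * y))) / t)
    ((Beta a (1 - a) / (1 + 0) powr a - Beta a (1 - a) / (1 + t) powr a) / t)"
    by (intro has_bochner_integral_divide_zero has_bochner_integral_diff has_bochner_integral_beta_kernel)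
      (use assms in auto)
  moreover have "(Beta a (1 - a) / (1 + 0) powr a - Beta a (1 - a) / (1 + t) powr a) / t =
      Beta a (1 - a) * (1 - (1 + t) powr - a) / t"
    by (simp add: powr_minus_divide algebra_simps)
  moreover have "(indicator {0<..<1} y * (?k y / (1 + 0 * y)) - indicator {0<..<1} y * (?k y / (1 + t * y))) / t =
      indicator {0<..<1} y * (1 / y\<^sup>2 * ((1 / y - 1) powr - a / (1 + (1 / y - 1)) / (t + (1 + (1 / y - 1)))))" for y
  proof (cases "y \<in> {0<..<1}")
    case True
    then have y: "0 < y" "y < 1" by auto
    have p: "0 < 1 + t * y" using y assms by (simp add: add_pos_pos)
    have "1 / y\<^sup>2 * ((1 / y - 1) powr - a / (1 + (1 / y - 1)) / (t + (1 + (1 / y - 1)))) =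
      ?k y / (t + (1 + (1 / y - 1)))"
      unfolding beta_prime_inverse_shift[OF y, symmetric] by simp
    also have "\<dots> = ?k y * ((1 - 1 / (1 + t * y)) / t)"
    proof -
      have "1 - 1 / (1 + t * y) = t * y / (1 + t * y)" using p by (simp add: field_simps)
      moreover have "t + (1 + (1 / y - 1)) = (1 + t * y) / y" using y by (simp add: field_simps)
      ultimately show ?thesis using assms by simp
    qed
    finally have eq: "1 / y\<^sup>2 * ((1 / y - 1) powr - a / (1 + (1 / y - 1)) / (t + (1 + (1 / y - 1)))) =
      ?k y * ((1 - 1 / (1 + t * y)) / t)" .
    show ?thesis unfolding eq using True by (simp add: right_diff_distrib diff_divide_distrib)
  qed simp
  ultimately show "has_bochner_integral lborel
      (\<lambda>y. indicator {0<..<1} y * (1 / y\<^sup>2 * ((1 / y - 1) powr - a / (1 + (1 / y - 1)) / (t + (1 + (1 / y - 1))))))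
      (Beta a (1 - a) * (1 - (1 + t) powr - a) / t)"
    by (simp only:)
qed simp

section \<open>The two families and their eta transforms\<close>

lemma real_distribution_density:
  assumes "has_bochner_integral lborel f 1" "\<And>x. 0 \<le> f x"
  shows "real_distribution (density lborel (\<lambda>x. ennreal (f x)))"
proof -
  have [measurable]: "f \<in> borel_measurable lborel"
    using assms(1) by (auto simp: has_bochner_integral_iff)
  have "(\<integral>\<^sup>+x. ennreal (f x) \<partial>lborel) = 1"
    using assms by (subst nn_integral_eq_integral) (auto simp: has_bochner_integral_iff)
  then have "prob_space (density lborel (\<lambda>x. ennreal (f x)))"
    by (intro prob_spaceI) (simp add: emeasure_density cong: nn_integral_cong)
  then show ?thesis
    by (simp add: real_distribution_def real_distribution_axioms_def)
qed

lemma Beta_pos: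
  fixes a b :: real
  assumes "0 < a" "0 < b"
  shows "0 < Beta a b"
  using assms by (simp add: Beta_def)

text \<open>Closed and open intervals give the same density at every point: at either endpoint one
  factor is a power of 0, and \<open>0 powr p = 0\<close> even for negative
  \<open>p\<close>.\<close>

lemma beta_tilde_eq_density:
  fixes a :: real
  assumes "0 < a" "a < 1"
  shows "beta_tilde a = density lborel
    (\<lambda>x. ennreal (indicator {0<..<1} x * (x powr (a - 1) * (1 - x) powr - a) / Beta a (1 - a)))"
  unfolding beta_tilde_def beta_measure_def
  by (rule arg_cong[where f = "density lborel"], rule ext) (auto split: split_indicator)

lemma nonneg_distribution_beta_tilde:
  fixes a :: real
  assumes "0 < a" "a < 1"
  shows "nonneg_distribution (beta_tilde a)"
proof -
  have B: "0 < Beta a (1 - a)" using assms by (intro Beta_pos) auto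
  have "has_bochner_integral lborel
    (\<lambda>x. indicator {0<..<1} x * (x powr (a - 1) * (1 - x) powr - a) / Beta a (1 - a))
    (Beta a (1 - a) / Beta a (1 - a))"
    using has_bochner_integral_beta_kernel[of a 0] assms
    by (intro has_bochner_integral_divide_zero) simp
  then have "real_distribution (beta_tilde a)"
    unfolding beta_tilde_eq_density[OF assms] using B
    by (intro real_distribution_density) auto
  moreover have "AE x in beta_tilde a. 0 \<le> x"
    unfolding beta_tilde_eq_density[OF assms]
    by (subst AE_density) (auto split: split_indicator)
  ultimately show ?thesis by (simp add: nonneg_distribution_def)
qed

text \<open>Since \<open>1 / (1 / w - x) = w / (1 - w * x)\<close>, the beta kernel integral with
  \<open>c = - w\<close> gives the Cauchy transform \<open>w / (1 - w) powr a\<close> at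
  \<open>1 / w\<close>.\<close>

lemma eta_transform_beta_tilde:
  fixes a w :: real
  assumes "0 < a" "a < 1" "w < 0"
  shows "eta_transform (beta_tilde a) (complex_of_real w) = complex_of_real (1 - (1 - w) powr a)"
proof -
  let ?B = "Beta a (1 - a)"
  have B: "0 < ?B" using assms by (intro Beta_pos) auto
  have eq: "indicator {0<..<1} x * (x powr (a - 1) * (1 - x) powr - a) / ?B * (1 / (1 / w - x)) =
      w / ?B * (indicator {0<..<1} x * (x powr (a - 1) * (1 - x) powr - a / (1 + (- w) * x)))" for x
  proof -
    have "1 / (1 / w - x) = w / (1 + (- w) * x)"
      using assms by (simp add: field_simps)
    then show ?thesis by simp
  qed
  have "(LINT x|beta_tilde a. 1 / (1 / w - x)) =
      (LINT x|lborel. indicator {0<..<1} x * (x powr (a - 1) * (1 - x) powr - a) / ?B * (1 / (1 / w - x)))"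
    unfolding beta_tilde_eq_density[OF assms(1,2)] using B
    by (subst integral_real_density) auto
  also have "\<dots> = w / ?B * (?B / (1 + (- w)) powr a)"
    unfolding eq
    using has_bochner_integral_beta_kernel[of a "- w"] assms
    by (subst integral_mult_right_zero) (simp add: has_bochner_integral_iff)
  also have "\<dots> = w / (1 - w) powr a"
    using B by simp
  finally have "(LINT x|beta_tilde a. 1 / (1 / w - x)) = w / (1 - w) powr a" .
  moreover have "eta_transform (beta_tilde a) (complex_of_real w) =
      complex_of_real (1 - w * (1 / (LINT x|beta_tilde a. 1 / (1 / w - x))))"
    using assms cauchy_transform_of_real[of "beta_tilde a" "1 / w"]
    by (simp add: eta_transform_def F_transform_def)
  ultimately show ?thesis using assms by simp
qed

text \<open>The parameters sum to 1, so the power of \<open>1 + x\<close> is the first one. The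
  point 0 may be dropped because \<open>0 powr - a = 0\<close>.\<close>

lemma beta_prime_measure_eq_density:
  fixes a :: real
  assumes "0 < a" "a < 1"
  shows "beta_prime_measure (1 - a) a = density lborel
    (\<lambda>x. ennreal (indicator {0<..} x * (x powr - a / (1 + x)) / Beta a (1 - a)))"
  unfolding beta_prime_measure_def
  by (rule arg_cong[where f = "density lborel"], rule ext)
    (auto simp: Beta_commute split: split_indicator)

lemma nonneg_distribution_beta_prime_tilde:
  fixes a :: real
  assumes "0 < a" "a < 1"
  shows "nonneg_distribution (beta_prime_tilde a)"
proof -
  have B: "0 < Beta a (1 - a)" using assms by (intro Beta_pos) auto
  have "has_bochner_integral lborel
    (\<lambda>x. indicator {0<..} x * (x powr - a / (1 + x)) / Beta a (1 - a))
    (Beta a (1 - a) / Beta a (1 - a))"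
    by (intro has_bochner_integral_divide_zero has_bochner_integral_beta_prime assms)
  then have rd: "real_distribution (beta_prime_measure (1 - a) a)"
    unfolding beta_prime_measure_eq_density[OF assms] using B
    by (intro real_distribution_density) (auto split: split_indicator)
  interpret real_distribution "beta_prime_measure (1 - a) a" by (rule rd)
  have "AE x in beta_prime_measure (1 - a) a. 0 \<le> x + 1"
    unfolding beta_prime_measure_eq_density[OF assms]
    by (subst AE_density) (auto split: split_indicator)
  then have "AE x in beta_prime_tilde a. 0 \<le> x"
    unfolding beta_prime_tilde_def by (subst AE_distr_iff) auto
  moreover have "real_distribution (beta_prime_tilde a)"
    unfolding beta_prime_tilde_def by simp
  ultimately show ?thesis by (simp add: nonneg_distribution_def)
qed

text \<open>With \<open>t = - 1 / w\<close> and \<open>Q = (1 + t) powr a\<close>, the Cauchy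
  transform at \<open>1 / w = - t\<close> is \<open>w * (1 - 1 / Q)\<close>, and
  \<open>1 - 1 / (1 - 1 / Q) = 1 / (1 - Q)\<close>.\<close>

lemma eta_transform_beta_prime_tilde:
  fixes a w :: real
  assumes "0 < a" "a < 1" "w < 0"
  shows "eta_transform (beta_prime_tilde a) (complex_of_real w) =
    complex_of_real (1 / (1 - (1 - 1 / w) powr a))"
proof -
  let ?B = "Beta a (1 - a)"
  define t where "t = - 1 / w"
  have t: "0 < t" "1 / w = - t" "w = - 1 / t" using assms by (auto simp: t_def)
  have B: "0 < ?B" using assms by (intro Beta_pos) auto
  have eq: "indicator {0<..} x * (x powr - a / (1 + x)) / ?B * (1 / (- t - (x + 1))) =
      - 1 / ?B * (indicator {0<..} x * (x powr - a / (1 + x) / (t + (1 + x))))" for x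
  proof -
    have "- t - (x + 1) = - (t + (1 + x))" by simp
    then have "1 / (- t - (x + 1)) = - (1 / (t + (1 + x)))" by (metis minus_divide_right)
    then show ?thesis by simp
  qed
  have "(LINT x|beta_prime_tilde a. 1 / (- t - x)) =
      (LINT x|beta_prime_measure (1 - a) a. 1 / (- t - (x + 1)))"
    unfolding beta_prime_tilde_def
    by (subst integral_distr) (auto simp: beta_prime_measure_def)
  also have "\<dots> = (LINT x|lborel. indicator {0<..} x * (x powr - a / (1 + x)) / ?B * (1 / (- t - (x + 1))))"
    unfolding beta_prime_measure_eq_density[OF assms(1,2)] using B
    by (subst integral_real_density) (auto split: split_indicator)
  also have "\<dots> = - 1 / ?B * (?B * (1 - (1 + t) powr - a) / t)"
    unfolding eq
    using has_bochner_integral_beta_prime_kernel[of a t] assms t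
    by (subst integral_mult_right_zero) (simp add: has_bochner_integral_iff)
  also have "\<dots> = w * (1 - (1 + t) powr - a)"
    using B t(1) unfolding t(3) by (simp add: field_simps)
  finally have G: "(LINT x|beta_prime_tilde a. 1 / (1 / w - x)) = w * (1 - 1 / (1 + t) powr a)"
    by (simp add: t powr_minus_divide)
  \<comment> \<open>Keeps both denominators \<open>1 - 1 / Q\<close> and \<open>1 - Q\<close> away
    from 0.\<close>
  have "1 < (1 + t) powr a" using t assms by simp
  moreover have "1 - w * (1 / (w * (1 - 1 / Q))) = 1 / (1 - Q)" if "1 < Q" for Q
    using assms that by (simp add: field_simps)
  ultimately have "1 - w * (1 / (w * (1 - 1 / (1 + t) powr a))) = 1 / (1 - (1 - 1 / w) powr a)"
    unfolding t(2) by simp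
  moreover have "eta_transform (beta_prime_tilde a) (complex_of_real w) =
      complex_of_real (1 - w * (1 / (LINT x|beta_prime_tilde a. 1 / (1 / w - x))))"
    using assms cauchy_transform_of_real[of "beta_prime_tilde a" "1 / w"]
    by (simp add: eta_transform_def F_transform_def)
  ultimately show ?thesis by (simp add: G)
qed

section \<open>Composition of the eta transforms\<close>

theorem mainTheorem8:
  fixes a b :: real
  assumes "0 < a" and "a < 1" and "0 < b" and "b < 1"
  shows "mult_monotone_conv (beta_tilde a) (beta_tilde b) = beta_tilde (a * b) \<and>
         mult_monotone_conv (beta_prime_tilde a) (beta_prime_tilde b) = beta_prime_tilde (a * b)"
proof
  have ab: "0 < a * b" "a * b < 1"
    using assms mult_strict_mono[of a 1 b 1] by auto
  show "mult_monotone_conv (beta_tilde a) (beta_tilde b) = beta_tilde (a * b)"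
  proof (rule mult_monotone_conv_eqI)
    fix z :: real assume z: "z < 0"
    \<comment> \<open>Hence the inner eta value is negative, and the closed form applies to it a
      second time.\<close>
    have "1 < (1 - z) powr b" using z assms by simp
    then show "eta_transform (beta_tilde (a * b)) (complex_of_real z) =
        eta_transform (beta_tilde a) (eta_transform (beta_tilde b) (complex_of_real z))"
      using assms ab z
      by (simp add: eta_transform_beta_tilde powr_powr mult.commute del: of_real_diff)
  qed (use ab in \<open>simp add: nonneg_distribution_beta_tilde\<close>)
  show "mult_monotone_conv (beta_prime_tilde a) (beta_prime_tilde b) = beta_prime_tilde (a * b)"
  proof (rule mult_monotone_conv_eqI)
    fix z :: real assume z: "z < 0"
    \<comment> \<open>Again the inner value must be shown negative. For
      \<open>v = 1 / (1 - Q)\<close> one has \<open>1 - 1 / v = Q\<close>, so the outer formula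
      raises \<open>Q = (1 - 1 / z) powr b\<close> to the power \<open>a\<close>.\<close>
    have "1 < 1 - 1 / z" using z by simp
    then have "1 < (1 - 1 / z) powr b" using assms by simp
    then have "1 / (1 - (1 - 1 / z) powr b) < 0" by simp
    then show "eta_transform (beta_prime_tilde (a * b)) (complex_of_real z) =
        eta_transform (beta_prime_tilde a) (eta_transform (beta_prime_tilde b) (complex_of_real z))"
      using assms ab z
      by (simp add: eta_transform_beta_prime_tilde powr_powr mult.commute
          del: of_real_diff of_real_divide)
  qed (use ab in \<open>simp add: nonneg_distribution_beta_prime_tilde\<close>)
qed

end
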